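(* Let $2\le k\le m$ be integers and let $S$ be a $(k,m)$-agreeable product society. (1) If $S$ is a 2-box society and $|S|\ge\frac{m(m-1)}{k-1}$, then $$\frac{a(S)}{|S|}\ge\frac{(k-1)^2}{(m-1)^2}.$$ (2) If $S$ is a cylindrical society and $|S|\ge\frac{m(m-1)}{k-1}$, then $$\frac{a(S)}{|S|}>\frac{(k-1)^2}{m(m-1)}.$$ (3) If $S$ is a toroidal society and $|S|\ge\frac{m^2}{k-1}$, then $$\frac{a(S)}{|S|}>\frac{(k-1)^2}{m^2}.$$
   Context: A society is a triple $(X,V,\mathcal{A})$ consisting of a set $X$ (the spectrum, whose elements are called platforms), a finite set $V$ of voters, and a collection $\mathcal{A}=\{A_v\}_{v\in V}$ indexed by the voters, where $A_v\subseteq X$ is the approval set of voter $v$ (different voters may have equal approval sets). The size $|S|$ of a society $S$ is its number of voters. The agreement number $a(S)$ is the greatest number of voters that approve a single platform, i.e. $a(S)=\max_{p\in X}|\{v\in V: p\in A_v\}|$. The agreement proportion is $a(S)/|S|$. For integers $1\le k\le m\le|S|$, the society is $(k,m)$-agreeable if among every $m$ voters there are $k$ voters whose approval sets have a common platform; being $(k,m)$-agreeable includes $m\le |S|$. A linear society has as spectrum a closed subset of $\mathbb{R}$, and its approval sets are closed and bounded intervals of $\mathbb{R}$ (contained in the spectrum). A circular society has as spectrum a circle, and its approval sets are connected subsets of the circle. Given societies $(X,V,\{A^X_v\})$ and $(Y,V,\{A^Y_v\})$ with the same voters $V$, their product society is $(X\times Y,V,\mathcal{A}^{X\times Y})$,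 where $\mathcal{A}^{X\times Y}=\{A^X_v\times A^Y_v\mid v\in V\}$. A 2-box society is a product of two linear societies, with spectrum $\mathbb{R}^2$, so the approval sets are axis-parallel rectangles. A cylindrical society is a product of a linear society and a circular society. A toroidal society is a product of two circular societies. *)

theory Defs
  imports "HOL-Analysis.Analysis"
begin

text \<open>
  The indexed collection of approval sets is a function \<open>approval S\<close>, so distinct voters may have
  equal approval sets. Its values outside \<open>voters S\<close> are irrelevant, and no definition below
  depends on them.
\<close>

record ('p, 'v) society =
  spectrum :: "'p set"
  voters :: "'v set"
  approval :: "'v \<Rightarrow> 'p set"

definition is_society :: "('p, 'v) society \<Rightarrow> bool" where
  "is_society S \<longleftrightarrow> finite (voters S) \<and> (\<forall>v\<in>voters S. approval S v \<subseteq> spectrum S)"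

definition society_size :: "('p, 'v) society \<Rightarrow> nat" where
  "society_size S = card (voters S)"

text \<open>
  For a society with nonempty spectrum the maximum ranges over a nonempty set of numbers bounded
  by the size. A \<open>(k, m)\<close>-agreeable society always has nonempty spectrum.
\<close>

definition agreement_number :: "('p, 'v) society \<Rightarrow> nat" where
  "agreement_number S = Max ((\<lambda>p. card {v \<in> voters S. p \<in> approval S v}) ` spectrum S)"

definition agreement_proportion :: "('p, 'v) society \<Rightarrow> real" where
  "agreement_proportion S = real (agreement_number S) / real (society_size S)"

definition agreeable :: "nat \<Rightarrow> nat \<Rightarrow> ('p, 'v) society \<Rightarrow> bool" where
  "agreeable k m S \<longleftrightarrow>
     1 \<le> k \<and> k \<le> m \<and> m \<le> society_size S \<and>
     (\<forall>W. W \<subseteq> voters S \<and> card W = m \<longrightarrow>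
        (\<exists>U. U \<subseteq> W \<and> card U = k \<and> (\<exists>p\<in>spectrum S. \<forall>v\<in>U. p \<in> approval S v)))"

text \<open>
  Neither closed bounded intervals nor connected sets are required to be nonempty: a voter may
  approve of no platform.
\<close>

definition linear_society :: "(real, 'v) society \<Rightarrow> bool" where
  "linear_society S \<longleftrightarrow>
     is_society S \<and> closed (spectrum S) \<and> (\<forall>v\<in>voters S. \<exists>a b. approval S v = {a..b})"

definition circular_society :: "(complex, 'v) society \<Rightarrow> bool" where
  "circular_society S \<longleftrightarrow>
     is_society S \<and> (\<exists>c r. 0 < r \<and> spectrum S = sphere c r) \<and>
     (\<forall>v\<in>voters S. connected (approval S v))"

text \<open>
  Being a product is a relation rather than an operation, so that the two factors are forced to
  have the same voters and the values of \<open>approval S\<close> outside \<open>voters S\<close> stay unconstrained.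
\<close>

definition is_product_society ::
    "('p \<times> 'q, 'v) society \<Rightarrow> ('p, 'v) society \<Rightarrow> ('q, 'v) society \<Rightarrow> bool" where
  "is_product_society S X Y \<longleftrightarrow>
     voters X = voters S \<and> voters Y = voters S \<and>
     spectrum S = spectrum X \<times> spectrum Y \<and>
     (\<forall>v\<in>voters S. approval S v = approval X v \<times> approval Y v)"

definition two_box_society :: "(real \<times> real, 'v) society \<Rightarrow> bool" where
  "two_box_society S \<longleftrightarrow>
     (\<exists>X Y. linear_society X \<and> linear_society Y \<and> is_product_society S X Y) \<and>
     spectrum S = UNIV"

definition cylindrical_society :: "(real \<times> complex, 'v) society \<Rightarrow> bool" where
  "cylindrical_society S \<longleftrightarrow>
     (\<exists>X Y. linear_society X \<and> circular_society Y \<and> is_product_society S X Y)"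

definition toroidal_society :: "(complex \<times> complex, 'v) society \<Rightarrow> bool" where
  "toroidal_society S \<longleftrightarrow>
     (\<exists>X Y. circular_society X \<and> circular_society Y \<and> is_product_society S X Y)"

end

theory Submission
  imports Defs
begin

text \<open>
  A product is treated one factor at a time. Agreeability of the product passes to each factor, so
  some platform \<open>p\<close> of the first factor is approved by at least a proportion \<open>\<alpha>\<close> of all voters. The
  lower bound on the size guarantees that these are at least \<open>m\<close> voters, hence they form
  again a \<open>(k, m)\<close>-agreeable family, now in the second factor, and some \<open>q\<close> there is approved by a
  proportion \<open>\<beta>\<close> of them. The pair \<open>(p, q)\<close> is approved by a proportion \<open>\<alpha> * \<beta>\<close> of the voters
  (\<open>product_agreement\<close>). What remains is the one-dimensional bound for each kind of factor. Let \<open>n\<close>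
  be the number of voters and \<open>a\<close> the largest number of them sharing a point. In both cases a small
  \<open>a\<close> yields \<open>m\<close> voters no \<open>k\<close> of which share a point, contradicting agreeability.

  For intervals the proportion is at least \<open>(k - 1) / (m - 1)\<close> (\<open>linear_deep_point\<close>). The intervals
  can be coloured with \<open>a\<close> colours so that equal colours mean disjoint intervals. The \<open>k - 1\<close> most
  frequent colours cover at least \<open>n * (k - 1) / a\<close> voters, and among \<open>k\<close> of these voters two have
  the same colour. If \<open>a < n * (k - 1) / (m - 1)\<close>, the colours cover more than \<open>m - 1\<close> voters.

  For arcs of a circle the proportion exceeds \<open>(k - 1) / m\<close> (\<open>circular_deep_point\<close>). Colouring
  with \<open>a\<close> colours can fail here, so the \<open>m\<close> arcs are found differently. If no arc is nested
  inside another, the arcs can be ordered cyclically by their starts, and their ends come in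
  the same order. The arcs over one point are then consecutive, at most \<open>a\<close> of them, and \<open>m\<close> evenly
  spaced arcs meet each point at most \<open>k - 1\<close> times as soon as \<open>m * a \<le> n * (k - 1)\<close>
  (\<open>sparse_subfamily_of_unnested_arcs\<close>). If an arc is nested inside another, exchanging their end
  points preserves the number of arcs over every point, and a sparse selection after
  the exchange gives one before it: a selected arc of the new pair contains the old inner arc, and
  both together cover what the old pair covers. Lengths become more equal with each exchange, so
  the process stops (\<open>sparse_subfamily_of_arcs\<close>). To work with starts and ends at all, the circle is
  first replaced by finitely many of its points, among which every set of voters that is the set of
  all those approving some point occurs.
\<close>

section \<open>Interval families\<close>

text \<open>
  Greedy colouring by increasing left end. An interval already coloured that meets the next interval
  \<open>x\<close> contains the left end of \<open>x\<close>, so together with \<open>x\<close> there are at most \<open>a\<close> of them and some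
  colour is free. Empty intervals meet nothing and take whatever colour is free.
\<close>

lemma interval_colouring:
  fixes l r :: "'v \<Rightarrow> real" and a :: nat
  assumes "finite V" and "0 < a"
    and "\<And>p. card {v \<in> V. p \<in> {l v..r v}} \<le> a"
  shows "\<exists>c. c ` V \<subseteq> {..<a} \<and>
    (\<forall>u\<in>V. \<forall>v\<in>V. u \<noteq> v \<longrightarrow> c u = c v \<longrightarrow> {l u..r u} \<inter> {l v..r v} = {})"
  using assms(1,3)
proof (induction V rule: finite_ranking_induct[where f = l])
  case empty
  then show ?case by auto
next
  case (insert x S)
  show ?case
  proof (cases "x \<in> S")
    case True
    then show ?thesis using insert.IH insert.prems by (simp add: insert_absorb)
  next
    case False
    have "card {v \<in> S. p \<in> {l v..r v}} \<le> a" for p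
      using insert.prems[of p] card_mono[of "{v \<in> insert x S. p \<in> {l v..r v}}" "{v \<in> S. p \<in> {l v..r v}}"]
        insert.hyps(1) by fastforce
    from insert.IH[OF this] obtain c where c: "c ` S \<subseteq> {..<a}"
      and "\<forall>u\<in>S. \<forall>v\<in>S. u \<noteq> v \<longrightarrow> c u = c v \<longrightarrow> {l u..r u} \<inter> {l v..r v} = {}"
      by (elim exE conjE)
    then have disj: "{l u..r u} \<inter> {l v..r v} = {}"
      if "u \<in> S" "v \<in> S" "u \<noteq> v" "c u = c v" for u v
      using that by simp
    define B where "B = {v \<in> S. {l v..r v} \<inter> {l x..r x} \<noteq> {}}"
    have B_sub: "B \<subseteq> {v \<in> S. l x \<in> {l v..r v}}"
      using insert.hyps(2) unfolding B_def by force
    have "card B < a"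
    proof (cases "l x \<le> r x")
      case True
      then have "{v \<in> insert x S. l x \<in> {l v..r v}} = insert x {v \<in> S. l x \<in> {l v..r v}}"
        by auto
      then have "card {v \<in> insert x S. l x \<in> {l v..r v}} = Suc (card {v \<in> S. l x \<in> {l v..r v}})"
        using insert.hyps(1) \<open>x \<notin> S\<close> by simp
      moreover have "card B \<le> card {v \<in> S. l x \<in> {l v..r v}}"
        using B_sub insert.hyps(1) by (intro card_mono) auto
      ultimately show ?thesis using insert.prems[of "l x"] by linarith
    next
      case False
      then have "B = {}" unfolding B_def by auto
      then show ?thesis using \<open>0 < a\<close> by simp
    qed
    then have "card (c ` B) < card {..<a}"
      using card_image_le[of B c] insert.hyps(1) unfolding B_def by simp
    moreover have "finite (c ` B)" using insert.hyps(1) unfolding B_def by simp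
    ultimately have "\<not> {..<a} \<subseteq> c ` B" using card_mono leD by blast
    then obtain z where z: "z < a" "z \<notin> c ` B" by auto
    have zB: "{l v..r v} \<inter> {l x..r x} = {}" if "v \<in> S" "c v = z" for v
      using z(2) that unfolding B_def by blast
    show ?thesis
    proof (intro exI[of _ "c(x := z)"] conjI ballI impI)
      show "(c(x := z)) ` insert x S \<subseteq> {..<a}" using c z by auto
    next
      fix u v
      assume uv: "u \<in> insert x S" "v \<in> insert x S" "u \<noteq> v" "(c(x := z)) u = (c(x := z)) v"
      then consider "u = x" "v \<in> S" "c v = z" | "v = x" "u \<in> S" "c u = z"
        | "u \<in> S" "v \<in> S" "c u = c v"
        by (auto split: if_splits)
      then show "{l u..r u} \<inter> {l v..r v} = {}"
        using zB disj uv(3) by cases blast+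
    qed
  qed
qed

text \<open>
  The \<open>j\<close> largest values have at least the average share of the total. The induction discards a
  smallest value, which is at most the average of those kept.
\<close>

lemma heavy_subset:
  fixes f :: "'a \<Rightarrow> nat"
  assumes "finite A" and "j \<le> card A"
  shows "\<exists>C\<subseteq>A. card C = j \<and> j * sum f A \<le> card A * sum f C"
  using assms
proof (induction "card A - j" arbitrary: A)
  case 0
  then show ?case by (intro exI[of _ A]) auto
next
  case (Suc d)
  then have "A \<noteq> {}" by auto
  then obtain x where x: "x \<in> A" "\<And>y. y \<in> A \<Longrightarrow> f x \<le> f y"
    using ex_min_if_finite[of "f ` A"] Suc.prems(1) 
    by (metis arg_min_if_finite(1,2) linorder_not_less)
  define B where "B = A - {x}"
  have cB: "card A = Suc (card B)" and fB: "finite B" and sB: "sum f A = f x + sum f B"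
    using x(1) Suc.prems(1) card_Suc_Diff1[of A x] sum.remove[of A x f] unfolding B_def by auto
  have "d = card B - j" "j \<le> card B" using Suc.hyps(2) cB by auto
  then obtain C where C: "C \<subseteq> B" "card C = j" "j * sum f B \<le> card B * sum f C"
    using Suc.hyps(1) fB by blast
  have "j * f x \<le> sum f C"
    using sum_bounded_below[of C "f x" f] C x(2) unfolding B_def by auto
  then have "j * sum f A \<le> card A * sum f C"
    using C(3) unfolding cB sB by (simp add: distrib_left)
  then show ?case using C unfolding B_def by blast
qed

text \<open>
  Agreeability of a family of sets with no ambient spectrum, so that it can be restricted to the voters
  approving a fixed platform and transferred between the factors of a product.
\<close>

definition agreeing :: "nat \<Rightarrow> nat \<Rightarrow> 'v set \<Rightarrow> ('v \<Rightarrow> 'p set) \<Rightarrow> bool" where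
  "agreeing k m V A \<longleftrightarrow>
     (\<forall>W\<subseteq>V. card W = m \<longrightarrow> (\<exists>U\<subseteq>W. card U = k \<and> (\<exists>p. \<forall>v\<in>U. p \<in> A v)))"

lemma agreeing_obtain:
  assumes "agreeing k m V A" and "W \<subseteq> V" and "card W = m"
  obtains U p where "U \<subseteq> W" and "card U = k" and "\<And>v. v \<in> U \<Longrightarrow> p \<in> A v"
proof -
  have "\<exists>U\<subseteq>W. card U = k \<and> (\<exists>p. \<forall>v\<in>U. p \<in> A v)"
    using assms unfolding agreeing_def by simp
  then show thesis using that by auto
qed

lemma agreeing_imp_deep_point:
  assumes "agreeing k m V A" and "finite V" and "m \<le> card V"
  obtains p where "k \<le> card {v \<in> V. p \<in> A v}"
proof -
  obtain W where "W \<subseteq> V" "card W = m"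
    using assms(3) obtain_subset_with_card_n by metis
  then obtain U p where "U \<subseteq> W" "card U = k" "\<And>v. v \<in> U \<Longrightarrow> p \<in> A v"
    using agreeing_obtain[OF assms(1)] by metis
  then have "k \<le> card {v \<in> V. p \<in> A v}"
    using \<open>W \<subseteq> V\<close> assms(2) card_mono[of "{v \<in> V. p \<in> A v}" U] by auto
  then show thesis using that by blast
qed

lemma deepest_point:
  fixes A :: "'v \<Rightarrow> 'p set"
  assumes "finite V"
  obtains p where "\<And>q. card {v \<in> V. q \<in> A v} \<le> card {v \<in> V. p \<in> A v}"
proof -
  have "range (\<lambda>q. card {v \<in> V. q \<in> A v}) \<subseteq> {..card V}"
    using assms by (auto intro: card_mono)
  then have fin: "finite (range (\<lambda>q. card {v \<in> V. q \<in> A v}))"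
    using finite_subset by blast
  then have "Max (range (\<lambda>q. card {v \<in> V. q \<in> A v})) \<in> range (\<lambda>q. card {v \<in> V. q \<in> A v})"
    by (intro Max_in) auto
  then obtain p where "Max (range (\<lambda>q. card {v \<in> V. q \<in> A v})) = card {v \<in> V. p \<in> A v}"
    by blast
  then have "card {v \<in> V. q \<in> A v} \<le> card {v \<in> V. p \<in> A v}" for q
    using Max_ge[OF fin, of "card {v \<in> V. q \<in> A v}"] by auto
  then show thesis using that[of p] by blast
qed

text \<open>
  With \<open>a\<close> the largest depth, the \<open>k - 1\<close> fullest classes of a colouring in \<open>a\<close> colours contain at
  least \<open>card V * (k - 1) / a\<close> voters, which is at least \<open>m\<close> if the bound fails. Of any \<open>k\<close> voters
  chosen from these classes two share a colour, so they have no common point.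
\<close>

lemma linear_deep_point:
  fixes A :: "'v \<Rightarrow> real set"
  assumes fin: "finite V" and int: "\<And>v. v \<in> V \<Longrightarrow> \<exists>x y. A v = {x..y}"
    and k: "2 \<le> k" and m: "m \<le> card V" and agr: "agreeing k m V A"
  shows "\<exists>p. (k - 1) * card V \<le> (m - 1) * card {v \<in> V. p \<in> A v}"
proof (rule ccontr)
  assume "\<not> ?thesis"
  then have low: "(m - 1) * card {v \<in> V. p \<in> A v} < (k - 1) * card V" for p
    by (simp add: not_le)
  obtain l r where lr: "\<And>v. v \<in> V \<Longrightarrow> A v = {l v..r v}"
    using int by metis
  obtain p where p: "\<And>q. card {v \<in> V. q \<in> A v} \<le> card {v \<in> V. p \<in> A v}"
    using deepest_point[OF fin] by blast
  define a where "a = card {v \<in> V. p \<in> A v}"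
  have "k \<le> a"
    using agreeing_imp_deep_point[OF agr fin m] p unfolding a_def by (meson order_trans)
  have "card {v \<in> V. q \<in> {l v..r v}} \<le> a" for q
  proof -
    have "{v \<in> V. q \<in> {l v..r v}} = {v \<in> V. q \<in> A v}" using lr by auto
    then show ?thesis using p unfolding a_def by simp
  qed
  then obtain c where c: "c ` V \<subseteq> {..<a}"
    and disj: "\<And>u v. u \<in> V \<Longrightarrow> v \<in> V \<Longrightarrow> u \<noteq> v \<Longrightarrow> c u = c v \<Longrightarrow> A u \<inter> A v = {}"
    using interval_colouring[OF fin, of a l r] k \<open>k \<le> a\<close> lr by fastforce
  obtain C where C: "C \<subseteq> {..<a}" "card C = k - 1"
    and big: "(k - 1) * (\<Sum>i<a. card {v \<in> V. c v = i}) \<le> a * (\<Sum>i\<in>C. card {v \<in> V. c v = i})"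
  proof -
    have "k - 1 \<le> card {..<a}" using \<open>k \<le> a\<close> by simp
    from heavy_subset[OF finite_lessThan this, of "\<lambda>i. card {v \<in> V. c v = i}"]
    show thesis using that by auto
  qed
  have finC: "finite C" using C finite_subset by blast
  have classes: "(\<Sum>i\<in>D. card {v \<in> V. c v = i}) = card {v \<in> V. c v \<in> D}" if "finite D" for D
  proof -
    have "{v \<in> V. c v \<in> D} = (\<Union>i\<in>D. {v \<in> V. c v = i})" by auto
    also have "card \<dots> = (\<Sum>i\<in>D. card {v \<in> V. c v = i})"
      using that fin by (intro card_UN_disjoint) auto
    finally show ?thesis by simp
  qed
  have "{v \<in> V. c v \<in> {..<a}} = V" using c by auto
  then have "(k - 1) * card V \<le> a * card {v \<in> V. c v \<in> C}"
    using big classes[of C] classes[of "{..<a}"] finC by simp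
  then have "a * (m - 1) < a * card {v \<in> V. c v \<in> C}"
    using order.strict_trans2[OF low[of p]] unfolding a_def by (simp only: mult.commute)
  then have "m - 1 < card {v \<in> V. c v \<in> C}" by (simp only: mult_less_cancel1)
  then have "m \<le> card {v \<in> V. c v \<in> C}" by linarith
  then obtain W where W: "W \<subseteq> {v \<in> V. c v \<in> C}" "card W = m"
    by (rule obtain_subset_with_card_n)
  then have "W \<subseteq> V" by blast
  then obtain U q where U: "U \<subseteq> W" "card U = k" "\<And>v. v \<in> U \<Longrightarrow> q \<in> A v"
    using agreeing_obtain[OF agr \<open>W \<subseteq> V\<close> W(2)] by metis
  have "card C < card U" using C(2) U(2) k by simp
  moreover have "c ` U \<subseteq> C" using U(1) W(1) by auto
  ultimately have "\<not> inj_on c U"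
    using card_inj_on_le finC leD by blast
  then obtain u v where "u \<in> U" "v \<in> U" "u \<noteq> v" "c u = c v"
    unfolding inj_on_def by blast
  then show False
    using disj[of u v] U(3)[of u] U(3)[of v] U(1) \<open>W \<subseteq> V\<close> by blast
qed

section \<open>Arcs of a discrete circle\<close>

text \<open>
  Voter \<open>v\<close> stands for the arc of \<open>l v\<close> consecutive residues modulo \<open>N\<close> that begins at \<open>s v\<close>. For
  \<open>0 \<le> l v \<le> N\<close> this includes the empty arc and the whole circle.
\<close>

definition arc_depth :: "int \<Rightarrow> ('v \<Rightarrow> int) \<Rightarrow> ('v \<Rightarrow> int) \<Rightarrow> 'v set \<Rightarrow> int \<Rightarrow> nat" where
  "arc_depth N s l W x = card {v \<in> W. (x - s v) mod N < l v}"

lemma arc_depth_eq_sum: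
  "finite W \<Longrightarrow> arc_depth N s l W x = (\<Sum>v\<in>W. of_bool ((x - s v) mod N < l v))"
  unfolding arc_depth_def by (simp add: Int_def)

text \<open>
  Unroll the circle to the integers: the arcs become a doubly infinite periodic sequence of intervals
  from \<open>S i\<close> up to, but excluding, \<open>E i\<close>, with \<open>n\<close> of them per period. Sorting by start, with ties broken
  by length, makes \<open>S\<close> monotone, and the absence of nesting makes \<open>E\<close> monotone too. The indices of
  the intervals containing a given integer therefore form a block, of length at most \<open>a\<close>. The selected
  indices are \<open>(j * n) div m\<close>; any \<open>w + 1\<close> of them span at least \<open>w * n div m \<ge> a\<close> steps, so they do
  not fit into one block.

  The hypothesis \<open>unnested\<close> measures the clockwise distance from the start of \<open>v\<close> to the start of
  \<open>u\<close>: unless the starts agree, \<open>u\<close> does not end strictly before \<open>v\<close> does.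
\<close>

lemma sparse_subfamily_of_unnested_arcs:
  fixes s l :: "'v \<Rightarrow> int" and N :: int
  assumes fin: "finite V" and m: "0 < m" "m \<le> card V"
    and bounds: "\<And>v. v \<in> V \<Longrightarrow> 0 \<le> s v \<and> s v < N \<and> 0 \<le> l v \<and> l v \<le> N"
    and depth: "\<And>x. arc_depth N s l V x \<le> a"
    and count: "m * a \<le> card V * w"
    and unnested: "\<And>u v. u \<in> V \<Longrightarrow> v \<in> V \<Longrightarrow> (s u - s v) mod N = 0 \<or> l v \<le> (s u - s v) mod N + l u"
  shows "\<exists>W\<subseteq>V. card W = m \<and> (\<forall>x. arc_depth N s l W x \<le> w)"
proof -
  define n where "n = int (card V)"
  have n0: "0 < n" using m unfolding n_def by linarith
  obtain v0 where "v0 \<in> V" using m by fastforce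
  then have N0: "0 < N" using bounds[of v0] by linarith
  \<comment> \<open>Since lengths are at most \<open>N\<close>, this key orders lexicographically by start, then length.\<close>
  define key where "key = (\<lambda>v. s v * (N + 1) + l v)"
  obtain ys where ys: "set ys = V" "distinct ys"
    using finite_distinct_list[OF fin] by blast
  define xs where "xs = sort_key key ys"
  have xs: "set xs = V" "distinct xs" "sorted (map key xs)"
    using ys unfolding xs_def by auto
  have len: "int (length xs) = n"
    using distinct_card[OF xs(2)] xs(1) unfolding n_def by simp
  \<comment> \<open>The sorted list of arcs, repeated once per turn and indexed by all integers.\<close>
  define arc where "arc = (\<lambda>i::int. xs ! nat (i mod n))"
  define S where "S = (\<lambda>i. s (arc i) + (i div n) * N)"
  define E where "E = (\<lambda>i. S i + l (arc i))"
  have idx: "nat (i mod n) < length xs" for i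
    using len pos_mod_bound[OF n0, of i] pos_mod_sign[OF n0, of i] by linarith
  have arcV: "arc i \<in> V" for i
    using idx xs(1) unfolding arc_def by auto
  have lex: "s (arc i) < s (arc j) \<or> s (arc i) = s (arc j) \<and> l (arc i) \<le> l (arc j)"
    if "i mod n \<le> j mod n" for i j
  proof -
    have "key (arc i) \<le> key (arc j)"
      using sorted_nth_mono[OF xs(3), of "nat (i mod n)" "nat (j mod n)"] that idx[of i] idx[of j]
      unfolding arc_def by (simp add: nat_mono)
    then have le: "s (arc i) * (N + 1) + l (arc i) \<le> s (arc j) * (N + 1) + l (arc j)"
      unfolding key_def .
    have "s (arc i) \<le> s (arc j)"
    proof (rule ccontr)
      assume "\<not> ?thesis"
      then have "(s (arc j) + 1) * (N + 1) \<le> s (arc i) * (N + 1)"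
        using N0 by (intro mult_right_mono) auto
      then show False
        using le bounds[OF arcV, of i] bounds[OF arcV, of j] by (simp add: distrib_right)
    qed
    then show ?thesis using le by fastforce
  qed
  have S_bounds: "(i div n) * N \<le> S i" "S i < (i div n + 1) * N" for i
    using bounds[OF arcV, of i] unfolding S_def by (auto simp: distrib_right)
  have S_mono: "S i \<le> S j" and S_eq: "S i = S j \<Longrightarrow> l (arc i) \<le> l (arc j)" if "i \<le> j" for i j
  proof -
    have "i div n \<le> j div n" using that n0 by (simp add: zdiv_mono1)
    then consider "i div n = j div n" | "i div n + 1 \<le> j div n" by linarith
    then have "S i \<le> S j \<and> (S i = S j \<longrightarrow> l (arc i) \<le> l (arc j))"
    proof cases
      case 1
      have "i mod n \<le> j mod n"
        using that 1 by (simp add: minus_div_mult_eq_mod [symmetric])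
      then show ?thesis using lex[of i j] 1 unfolding S_def by auto
    next
      case 2
      then have "(i div n + 1) * N \<le> (j div n) * N"
        using N0 by (intro mult_right_mono) auto
      then show ?thesis using S_bounds(2)[of i] S_bounds(1)[of j] by linarith
    qed
    then show "S i \<le> S j" "S i = S j \<Longrightarrow> l (arc i) \<le> l (arc j)" by auto
  qed
  have E_mono: "E i \<le> E j" if "i \<le> j" for i j
  proof (cases "S i = S j")
    case True
    then show ?thesis using S_eq[OF that] unfolding E_def by simp
  next
    case False
    then have pos: "0 < S j - S i" using S_mono[OF that] by simp
    show ?thesis
    proof (cases "S j - S i < N")
      case True
      have "S j - S i = (s (arc j) - s (arc i)) + (j div n - i div n) * N"
        unfolding S_def by (simp add: algebra_simps)
      then have "(S j - S i) mod N = (s (arc j) - s (arc i)) mod N" by simp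
      then have "(s (arc j) - s (arc i)) mod N = S j - S i" using pos True by simp
      then show ?thesis
        using unnested[OF arcV arcV, of j i] pos unfolding E_def by simp
    next
      case False
      then show ?thesis
        using bounds[OF arcV, of i] bounds[OF arcV, of j] unfolding E_def by linarith
    qed
  qed
  have covers: "(x - s (arc i)) mod N < l (arc i)" if "S i \<le> x" "x < E i" for i x
  proof -
    have "x - s (arc i) = (x - S i) + (i div n) * N" unfolding S_def by simp
    then have "(x - s (arc i)) mod N = (x - S i) mod N" by (simp only: mod_mult_self1)
    also have "\<dots> = x - S i"
      using that bounds[OF arcV, of i] unfolding E_def by (intro mod_pos_pos_trivial) auto
    finally show ?thesis using that unfolding E_def by simp
  qed
  \<comment> \<open>No arc is longer than \<open>N\<close>, so two of its lifts never contain the same integer.\<close>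
  have inj: "inj_on arc {i. S i \<le> x \<and> x < E i}" for x
  proof (rule inj_onI)
    fix i j
    assume i: "i \<in> {i. S i \<le> x \<and> x < E i}" and j: "j \<in> {i. S i \<le> x \<and> x < E i}" and eq: "arc i = arc j"
    have md: "i mod n = j mod n"
      using eq nth_eq_iff_index_eq[OF xs(2) idx[of i] idx[of j]] n0 unfolding arc_def
      by (simp add: nat_eq_iff)
    have "\<bar>S i - S j\<bar> < N"
      using i j bounds[OF arcV, of i] bounds[OF arcV, of j] unfolding E_def by auto
    moreover have "S i - S j = (i div n - j div n) * N"
      using eq unfolding S_def by (simp add: algebra_simps)
    ultimately have "\<bar>i div n - j div n\<bar> * N < 1 * N" using N0 by (simp add: abs_mult)
    then have "i div n = j div n" using N0 by (simp only: mult_less_cancel_right_pos; linarith)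
    then show "i = j" using md by (metis div_mult_mod_eq)
  qed
  define pick where "pick = (\<lambda>j::int. (j * n) div int m)"
  \<comment> \<open>Since \<open>pick (j + m) = pick j + n\<close>, selecting the arcs with \<open>0 \<le> j < m\<close> selects all lifts
    whose index is \<open>pick j\<close> for some integer \<open>j\<close>.\<close>
  have pick_add: "pick j + d \<le> pick j'" if "j * n + d * int m \<le> j' * n" for j j' d
  proof -
    have "pick j + d = (j * n + d * int m) div int m" using m(1) unfolding pick_def by simp
    also have "\<dots> \<le> pick j'" using that unfolding pick_def by (intro zdiv_mono1) (use m in auto)
    finally show ?thesis .
  qed
  have "int m \<le> n" using m unfolding n_def by simp
  have pick_less: "pick j < pick j'" if "j < j'" for j j'
  proof -
    have "(j + 1) * n \<le> j' * n" using that n0 by (intro mult_right_mono) auto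
    then have "j * n + 1 * int m \<le> j' * n" using \<open>int m \<le> n\<close> by (simp add: distrib_right)
    then show ?thesis using pick_add[of j 1 j'] by simp
  qed
  have pick_range: "0 \<le> pick j \<and> pick j < n" if "0 \<le> j" "j < int m" for j
  proof -
    have "pick 0 = 0" "pick (int m) = n" using m(1) unfolding pick_def by auto
    then show ?thesis using pick_less[of 0 j] pick_less[of j "int m"] that by (cases "j = 0") auto
  qed
  define W where "W = (arc \<circ> pick) ` {0..<int m}"
  have "inj_on (arc \<circ> pick) {0..<int m}"
  proof (rule inj_onI)
    fix i j assume i: "i \<in> {0..<int m}" and j: "j \<in> {0..<int m}" and eq: "(arc \<circ> pick) i = (arc \<circ> pick) j"
    have "pick i mod n = pick i" "pick j mod n = pick j"
      using pick_range[of i] pick_range[of j] i j by auto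
    then have "pick i = pick j"
      using eq nth_eq_iff_index_eq[OF xs(2) idx[of "pick i"] idx[of "pick j"]]
        pick_range[of i] pick_range[of j] i j
      unfolding arc_def by (simp add: nat_eq_iff)
    then show "i = j" using pick_less[of i j] pick_less[of j i] by fastforce
  qed
  then have cardW: "card W = m" unfolding W_def by (metis card_image card_atLeastLessThan_int diff_zero nat_int)
  have "arc_depth N s l W x \<le> w" for x
  proof (rule ccontr)
    assume deep: "\<not> ?thesis"
    define Wx where "Wx = {v \<in> W. (x - s v) mod N < l v}"
    have finWx: "finite Wx" unfolding Wx_def W_def by auto
    have wx: "w < card Wx" using deep unfolding arc_depth_def Wx_def by simp
    have "\<exists>J. arc (pick J) = v \<and> S (pick J) \<le> x \<and> x < E (pick J)" if "v \<in> Wx" for v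
    proof -
      obtain j where j: "0 \<le> j" "j < int m" "v = arc (pick j)"
        using \<open>v \<in> Wx\<close> unfolding Wx_def W_def by auto
      define q where "q = (x - s v) div N"
      have "pick (q * int m + j) = (j * n + (q * n) * int m) div int m"
        unfolding pick_def by (simp add: algebra_simps)
      also have "\<dots> = q * n + pick j" using m(1) unfolding pick_def by simp
      finally have eq: "pick (q * int m + j) = q * n + pick j" .
      have arcq: "arc (pick (q * int m + j)) = v"
        unfolding eq arc_def using j(3) unfolding arc_def by simp
      have "pick (q * int m + j) div n = q"
        unfolding eq using pick_range[OF j(1,2)] by simp
      then have "x - S (pick (q * int m + j)) = (x - s v) mod N"
        using minus_div_mult_eq_mod[of "x - s v" N] unfolding S_def arcq q_def[symmetric] by simp
      moreover have "0 \<le> (x - s v) mod N" "(x - s v) mod N < l v"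
        using N0 that unfolding Wx_def by auto
      ultimately show ?thesis
        using arcq unfolding E_def by (intro exI[of _ "q * int m + j"]) auto
    qed
    then obtain J where J: "\<And>v. v \<in> Wx \<Longrightarrow> arc (pick (J v)) = v \<and> S (pick (J v)) \<le> x \<and> x < E (pick (J v))"
      by metis
    have "inj_on J Wx" using J by (metis inj_onI)
    then have cardJ: "card (J ` Wx) = card Wx" by (rule card_image)
    have ne: "J ` Wx \<noteq> {}" "finite (J ` Wx)" using wx finWx by auto
    obtain u where u: "u \<in> Wx" "J u = Min (J ` Wx)" using Min_in[OF ne(2,1)] by auto
    obtain v where v: "v \<in> Wx" "J v = Max (J ` Wx)" using Max_in[OF ne(2,1)] by auto
    have "J ` Wx \<subseteq> {J u..J v}" using u v ne by auto
    then have "card (J ` Wx) \<le> nat (J v - J u + 1)"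
      using card_mono[of "{J u..J v}" "J ` Wx"] by simp
    then have "J u + int w \<le> J v" using wx cardJ by linarith
    then have "(J u + int w) * n \<le> J v * n" using n0 by (intro mult_right_mono) auto
    moreover have "int a * int m \<le> int w * n"
      using count unfolding n_def by (metis mult.commute of_nat_le_iff of_nat_mult)
    ultimately have "J u * n + int a * int m \<le> J v * n" by (simp add: distrib_right)
    then have far: "pick (J u) + int a \<le> pick (J v)" by (rule pick_add)
    define I where "I = {pick (J u)..pick (J u) + int a}"
    have I_sub: "I \<subseteq> {i. S i \<le> x \<and> x < E i}"
    proof
      fix i assume "i \<in> I"
      then have "pick (J u) \<le> i" "i \<le> pick (J v)" using far unfolding I_def by auto
      then show "i \<in> {i. S i \<le> x \<and> x < E i}"
        using E_mono[of "pick (J u)" i] S_mono[of i "pick (J v)"] J[OF u(1)] J[OF v(1)] by auto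
    qed
    have "card I = card (arc ` I)"
      using inj_on_subset[OF inj I_sub] by (simp add: card_image)
    also have "\<dots> \<le> arc_depth N s l V x"
      unfolding arc_depth_def using I_sub arcV covers fin by (intro card_mono) auto
    finally show False using depth[of x] unfolding I_def by simp
  qed
  then show ?thesis using cardW arcV unfolding W_def by (intro exI[of _ W]) (auto simp: W_def)
qed

text \<open>
  Let the arc of \<open>u\<close> be nested in that of \<open>v\<close>, starting \<open>d\<close> later. Exchanging end points gives \<open>u\<close>
  the length \<open>l v - d\<close> and \<open>v\<close> the length \<open>d + l u\<close>: the old inner arc becomes the overlap of the new
  ones. This keeps all depths and lowers the sum of the squared lengths, on which the induction runs.
  A selection for the new arcs is pulled back by using \<open>u\<close>, the smallest of the four arcs, whenever it
  contains exactly one voter of the pair.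
\<close>

lemma sparse_subfamily_of_arcs:
  fixes s l :: "'v \<Rightarrow> int" and N :: int
  assumes fin: "finite V" and m: "0 < m" "m \<le> card V"
    and count: "m * a \<le> card V * w"
    and start: "\<And>v. v \<in> V \<Longrightarrow> 0 \<le> s v \<and> s v < N"
    and "\<And>v. v \<in> V \<Longrightarrow> 0 \<le> l v \<and> l v \<le> N"
    and "\<And>x. arc_depth N s l V x \<le> a"
  shows "\<exists>W\<subseteq>V. card W = m \<and> (\<forall>x. arc_depth N s l W x \<le> w)"
  using assms(6,7)
proof (induction "nat (\<Sum>v\<in>V. (l v)\<^sup>2)" arbitrary: l rule: less_induct)
  case less
  note len = less.prems(1) and depth = less.prems(2)
  show ?case
  proof (cases "\<forall>u\<in>V. \<forall>v\<in>V. (s u - s v) mod N = 0 \<or> l v \<le> (s u - s v) mod N + l u")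
    case True
    then show ?thesis
      using sparse_subfamily_of_unnested_arcs[OF fin m _ depth count] start len by auto
  next
    case False
    then obtain u v where uv: "u \<in> V" "v \<in> V" "(s u - s v) mod N \<noteq> 0"
      "(s u - s v) mod N + l u < l v" by (auto simp: not_le)
    define d where "d = (s u - s v) mod N"
    have N0: "0 < N" using start[OF uv(1)] by linarith
    have d: "0 < d" "d < N" "d + l u < l v" "u \<noteq> v"
      using uv N0 pos_mod_sign[OF N0, of "s u - s v"] pos_mod_bound[OF N0, of "s u - s v"]
      unfolding d_def by auto
    define l' where "l' = l(u := l v - d, v := d + l u)"
    have len': "0 \<le> l' z \<and> l' z \<le> N" if "z \<in> V" for z
      using len[OF that] len[OF uv(1)] len[OF uv(2)] d unfolding l'_def by auto
    \<comment> \<open>Both arcs starting at \<open>s u\<close>, seen in the coordinate that starts at \<open>s v\<close>. Neither reaches the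
      origin of that coordinate again, because the arc of \<open>v\<close> is at most one full turn.\<close>
    have cov: "((x - s u) mod N < l u \<longleftrightarrow> d \<le> (x - s v) mod N \<and> (x - s v) mod N < d + l u)"
      "((x - s u) mod N < l v - d \<longleftrightarrow> d \<le> (x - s v) mod N \<and> (x - s v) mod N < l v)" for x
    proof -
      define y where "y = (x - s v) mod N"
      have y: "0 \<le> y" "y < N" using N0 unfolding y_def by auto
      have "(x - s u) mod N = (x - s v - (s u - s v)) mod N" by simp
      also have "\<dots> = (y - d) mod N" unfolding y_def d_def by (simp add: mod_simps)
      also have "\<dots> = (if d \<le> y then y - d else y - d + N)"
      proof (cases "d \<le> y")
        case True
        then show ?thesis using y d by simp
      next
        case False
        then have "(y - d + N) mod N = y - d + N" using y d by (intro mod_pos_pos_trivial) auto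
        then show ?thesis using False by simp
      qed
      finally have "(x - s u) mod N = (if d \<le> y then y - d else y - d + N)" .
      then show "((x - s u) mod N < l u \<longleftrightarrow> d \<le> (x - s v) mod N \<and> (x - s v) mod N < d + l u)"
        "((x - s u) mod N < l v - d \<longleftrightarrow> d \<le> (x - s v) mod N \<and> (x - s v) mod N < l v)"
        using y d len[OF uv(1)] len[OF uv(2)] unfolding y_def[symmetric] by auto
    qed
    have both: "arc_depth N s l' W x = arc_depth N s l W x" if "u \<in> W" "v \<in> W" "finite W" for W x
    proof -
      have split: "(\<Sum>z\<in>W. f z) = f u + f v + (\<Sum>z\<in>W - {u} - {v}. f z)" for f :: "'v \<Rightarrow> nat"
        using that d(4) sum.remove[of W u f] sum.remove[of "W - {u}" v f] by simp
      have "(\<Sum>z\<in>W - {u} - {v}. of_bool ((x - s z) mod N < l' z)) =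
            (\<Sum>z\<in>W - {u} - {v}. of_bool ((x - s z) mod N < l z) :: nat)"
        by (intro sum.cong) (auto simp: l'_def)
      moreover have "of_bool ((x - s u) mod N < l' u) + of_bool ((x - s v) mod N < l' v) =
          of_bool ((x - s u) mod N < l u) + (of_bool ((x - s v) mod N < l v) :: nat)"
        using cov[of x] d len[OF uv(1)] unfolding l'_def by auto
      ultimately show ?thesis
        unfolding arc_depth_eq_sum[OF that(3)] split by linarith
    qed
    have "(\<Sum>z\<in>V. (l' z)\<^sup>2) < (\<Sum>z\<in>V. (l z)\<^sup>2)"
    proof -
      have split: "(\<Sum>z\<in>V. f z) = f u + f v + (\<Sum>z\<in>V - {u} - {v}. f z)" for f :: "'v \<Rightarrow> int"
        using uv fin d(4) sum.remove[of V u f] sum.remove[of "V - {u}" v f] by simp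
      have "(\<Sum>z\<in>V - {u} - {v}. (l' z)\<^sup>2) = (\<Sum>z\<in>V - {u} - {v}. (l z)\<^sup>2)"
        by (intro sum.cong) (auto simp: l'_def)
      moreover have "(l' u)\<^sup>2 + (l' v)\<^sup>2 = (l u)\<^sup>2 + (l v)\<^sup>2 - 2 * (d * (l v - l u - d))"
        using d(4) unfolding l'_def by (simp add: power2_eq_square algebra_simps)
      moreover have "0 < d * (l v - l u - d)" using d by simp
      ultimately show ?thesis unfolding split by linarith
    qed
    then have "nat (\<Sum>z\<in>V. (l' z)\<^sup>2) < nat (\<Sum>z\<in>V. (l z)\<^sup>2)"
      using sum_nonneg[of V "\<lambda>z. (l' z)\<^sup>2"] by (simp add: nat_less_eq_zless)
    moreover have "arc_depth N s l' V x \<le> a" for x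
      using both[OF uv(1,2) fin] depth by simp
    ultimately obtain W where W: "W \<subseteq> V" "card W = m" "\<And>x. arc_depth N s l' W x \<le> w"
      using less.hyps[of l'] len' by blast
    have finW: "finite W" using W(1) fin finite_subset by blast
    consider "u \<in> W" "v \<in> W" | "u \<notin> W" "v \<notin> W" | "u \<in> W" "v \<notin> W" | "u \<notin> W" "v \<in> W" by blast
    then show ?thesis
    proof cases
      case 1
      then show ?thesis using both[OF 1 finW] W by auto
    next
      case 2
      then have "arc_depth N s l W x = arc_depth N s l' W x" for x
        unfolding arc_depth_def l'_def by (intro arg_cong[of _ _ card]) auto
      then show ?thesis using W by (intro exI[of _ W]) simp
    next
      case 3
      then have le: "arc_depth N s l W x \<le> arc_depth N s l' W x" for x
        unfolding arc_depth_def using finW cov[of x] d by (intro card_mono) (auto simp: l'_def)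
      show ?thesis using W(1,2) order_trans[OF le W(3)] by blast
    next
      case 4
      \<comment> \<open>The new arc of \<open>v\<close> was selected; the old arc of \<open>u\<close> lies inside it and replaces it.\<close>
      define W' where "W' = insert u (W - {v})"
      have "card W' = m" using 4 finW W(2) card_Suc_Diff1[of W v] unfolding W'_def by simp
      moreover have "W' \<subseteq> V" using W uv unfolding W'_def by blast
      moreover have le: "arc_depth N s l W' x \<le> arc_depth N s l' W x" for x
      proof -
        define f where "f = (\<lambda>z. if z = v then u else z)"
        have "{z \<in> W'. (x - s z) mod N < l z} \<subseteq> f ` {z \<in> W. (x - s z) mod N < l' z}"
        proof
          fix z assume z: "z \<in> {z \<in> W'. (x - s z) mod N < l z}"
          show "z \<in> f ` {z \<in> W. (x - s z) mod N < l' z}"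
          proof (cases "z = u")
            case True
            then have "(x - s v) mod N < l' v" using z cov[of x] unfolding l'_def by simp
            then show ?thesis using True 4 unfolding f_def by (intro image_eqI[of _ _ v]) auto
          next
            case False
            then show ?thesis using z unfolding f_def W'_def l'_def by (intro image_eqI[of _ _ z]) auto
          qed
        qed
        then show ?thesis
          unfolding arc_depth_def using finW by (intro surj_card_le[where f = f]) auto
      qed
      ultimately show ?thesis using order_trans[OF le W(3)] by blast
    qed
  qed
qed


section \<open>Connected subsets of a circle\<close>

definition circle_point :: "complex \<Rightarrow> real \<Rightarrow> real \<Rightarrow> complex" where
  "circle_point c r \<theta> = c + of_real r * cis \<theta>"

lemma sphere_imp_circle_point:
  assumes "z \<in> sphere c r" and "0 < r"
  obtains \<theta> where "\<theta> \<in> {0..<2 * pi}" and "z = circle_point c r \<theta>"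
proof -
  have "norm (z - c) = r" using assms(1) by (simp add: dist_norm norm_minus_commute)
  moreover have "z - c = of_real (norm (z - c)) * cis (Arg2pi (z - c))"
    using Arg2pi_eq[of "z - c"] by (simp add: cis_conv_exp)
  ultimately show thesis
    using that[of "Arg2pi (z - c)"] Arg2pi_ge_0[of "z - c"] Arg2pi_lt_2pi[of "z - c"]
    unfolding circle_point_def by (simp add: algebra_simps)
qed

text \<open>
  The chord from angle \<open>\<alpha>\<close> to angle \<open>\<beta>\<close> cuts the circle into two open arcs lying on opposite sides of
  its line. A connected set that avoids both end points of the chord stays on one side.
\<close>

lemma chord_separates:
  assumes conn: "connected A" and A: "A \<subseteq> sphere c r" and r: "0 < r"
    and ord: "0 \<le> \<alpha>" "\<alpha> < \<beta>" "\<beta> < 2 * pi"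
    and out: "circle_point c r \<alpha> \<notin> A" "circle_point c r \<beta> \<notin> A"
    and \<sigma>: "\<sigma> \<in> {\<alpha><..<\<beta>}" "circle_point c r \<sigma> \<in> A"
    and \<tau>: "\<tau> \<in> {0..<2 * pi}" "circle_point c r \<tau> \<in> A"
  shows "\<tau> \<in> {\<alpha><..<\<beta>}"
proof (rule ccontr)
  assume no: "\<tau> \<notin> {\<alpha><..<\<beta>}"
  define \<mu> \<delta> where "\<mu> = (\<alpha> + \<beta>) / 2" and "\<delta> = (\<beta> - \<alpha>) / 2"
  \<comment> \<open>Signed distance to the line through the chord, after scaling to the unit circle: \<open>\<mu>\<close> is the
    direction of its normal and \<open>cos \<delta>\<close> its signed distance from the centre.\<close>
  define h where "h = (\<lambda>z. Re (cnj (cis \<mu>) * ((z - c) / of_real r)) - cos \<delta>)"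
  have h: "h (circle_point c r \<theta>) = cos (\<theta> - \<mu>) - cos \<delta>" for \<theta>
    using r unfolding h_def circle_point_def by (simp add: cis_cnj cis_mult)
  have \<delta>: "0 < \<delta>" "\<delta> < pi" using ord unfolding \<delta>_def by auto
  have inside: "h (circle_point c r \<theta>) > 0" if "\<theta> \<in> {\<alpha><..<\<beta>}" for \<theta>
  proof -
    have "\<bar>\<theta> - \<mu>\<bar> < \<delta>" using that unfolding \<mu>_def \<delta>_def by (auto simp: abs_less_iff field_simps)
    then have "cos \<delta> < cos \<bar>\<theta> - \<mu>\<bar>" using \<delta> by (intro cos_monotone_0_pi) auto
    then show ?thesis unfolding h by simp
  qed
  have outside: "h (circle_point c r \<theta>) < 0" if "\<theta> \<in> {0..<2 * pi} - {\<alpha>..\<beta>}" for \<theta>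
  proof -
    have bd: "\<delta> < \<bar>\<theta> - \<mu>\<bar>" "\<bar>\<theta> - \<mu>\<bar> < 2 * pi - \<delta>"
      using that ord unfolding \<mu>_def \<delta>_def by (auto simp: abs_if field_simps)
    have "cos \<bar>\<theta> - \<mu>\<bar> < cos \<delta>"
    proof (cases "\<bar>\<theta> - \<mu>\<bar> \<le> pi")
      case True
      then show ?thesis using bd \<delta> by (intro cos_monotone_0_pi) auto
    next
      case False
      then have "cos (2 * pi - \<bar>\<theta> - \<mu>\<bar>) < cos \<delta>" using bd \<delta> by (intro cos_monotone_0_pi) auto
      then show ?thesis by (simp add: cos_diff)
    qed
    then show ?thesis unfolding h by simp
  qed
  have "\<tau> \<noteq> \<alpha>" "\<tau> \<noteq> \<beta>" using \<tau> out by auto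
  then have "h (circle_point c r \<tau>) < 0" using outside \<tau>(1) no by auto
  moreover have "0 < h (circle_point c r \<sigma>)" using inside \<sigma>(1) by blast
  moreover have "continuous_on A h" unfolding h_def by (intro continuous_intros) (use r in auto)
  then have "connected (h ` A)" using conn connected_continuous_image by blast
  ultimately have "0 \<in> h ` A"
    using \<sigma>(2) \<tau>(2) connectedD_interval[of "h ` A" "h (circle_point c r \<tau>)" "h (circle_point c r \<sigma>)" 0]
    by simp
  then obtain z where z: "z \<in> A" "h z = 0" by auto
  then obtain \<theta> where \<theta>: "\<theta> \<in> {0..<2 * pi}" "z = circle_point c r \<theta>"
    using A sphere_imp_circle_point[OF _ r] by blast
  then have "\<theta> \<noteq> \<alpha>" "\<theta> \<noteq> \<beta>" using out z by auto
  then show False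
    using inside[of \<theta>] outside[of \<theta>] \<theta> z(2) by (cases "\<theta> \<in> {\<alpha><..<\<beta>}") auto
qed

text \<open>
  Membership in a connected subset of a circle cannot alternate along four points in cyclic order: the two
  points outside would bound a chord separating the two points inside.
\<close>

lemma no_alternation:
  assumes "connected A" and "A \<subseteq> sphere c r" and "0 < r"
    and "0 \<le> \<theta>1" "\<theta>1 < \<theta>2" "\<theta>2 < \<theta>3" "\<theta>3 < \<theta>4" "\<theta>4 < 2 * pi"
    and mem: "circle_point c r \<theta>1 \<in> A \<longleftrightarrow> circle_point c r \<theta>3 \<in> A"
      "circle_point c r \<theta>2 \<in> A \<longleftrightarrow> circle_point c r \<theta>4 \<in> A"
  shows "circle_point c r \<theta>1 \<in> A \<longleftrightarrow> circle_point c r \<theta>2 \<in> A"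
proof (rule ccontr)
  assume "\<not> ?thesis"
  then consider "circle_point c r \<theta>1 \<in> A" "circle_point c r \<theta>2 \<notin> A"
    | "circle_point c r \<theta>1 \<notin> A" "circle_point c r \<theta>2 \<in> A" by blast
  then show False
  proof cases
    case 1
    then show False
      using chord_separates[OF assms(1-3), of \<theta>2 \<theta>4 \<theta>3 \<theta>1] assms by auto
  next
    case 2
    then show False
      using chord_separates[OF assms(1-3), of \<theta>1 \<theta>3 \<theta>2 \<theta>4] assms by auto
  qed
qed

text \<open>
  Order convexity relative to the first \<open>N\<close> natural numbers.
\<close>

definition convex_in :: "nat \<Rightarrow> nat set \<Rightarrow> bool" where
  "convex_in N I \<longleftrightarrow> (\<forall>i j k. i < j \<longrightarrow> j < k \<longrightarrow> k < N \<longrightarrow> i \<in> I \<longrightarrow> k \<in> I \<longrightarrow> j \<in> I)"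

lemma convex_in_imp_interval:
  assumes "convex_in N I" and "I \<subseteq> {..<N}"
  obtains i j where "i \<le> j" and "j \<le> N" and "I = {i..<j}"
proof (cases "I = {}")
  case True
  then show thesis using that[of 0 0] by auto
next
  case False
  have fin: "finite I" using assms(2) finite_subset by blast
  have lt: "Max I < N" using Max_in[OF fin False] assms(2) by auto
  have "I = {Min I..<Suc (Max I)}"
  proof
    show "I \<subseteq> {Min I..<Suc (Max I)}" using fin by (auto simp: less_Suc_eq_le)
    show "{Min I..<Suc (Max I)} \<subseteq> I"
    proof
      fix x assume "x \<in> {Min I..<Suc (Max I)}"
      then have "x = Min I \<or> x = Max I \<or> (Min I < x \<and> x < Max I)" by auto
      then show "x \<in> I"
        using assms(1) lt Min_in[OF fin False] Max_in[OF fin False] unfolding convex_in_def by metis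
    qed
  qed
  then show thesis using that[of "Min I" "Suc (Max I)"] Min_le[OF fin Max_in[OF fin False]] lt by auto
qed

text \<open>
  Cutting the cycle of residues open between \<open>N - 1\<close> and \<open>0\<close> turns an arc into an interval or, if the
  cut is in its interior, into the complement of an interval. In the second form the arc starts where
  the complement ends; if that is \<open>N\<close>, the start is \<open>0\<close> as a residue.
\<close>

lemma arc_encoding:
  assumes cc: "convex_in N I \<or> convex_in N ({..<N} - I)" and I: "I \<subseteq> {..<N}" and N: "0 < N"
  obtains s l :: int where "0 \<le> s" and "s < int N" and "0 \<le> l" and "l \<le> int N"
    and "\<And>i. i < N \<Longrightarrow> i \<in> I \<longleftrightarrow> (int i - s) mod int N < l"
proof -
  have md: "(int i - t) mod int N = (if t \<le> int i then int i - t else int i - t + int N)"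
    if "i < N" "0 \<le> t" "t \<le> int N" for i t
  proof (cases "t \<le> int i")
    case True
    then show ?thesis using that by simp
  next
    case False
    show ?thesis
    proof -
      have "(int i - t) mod int N = (int i - t + int N) mod int N" by simp
      also have "\<dots> = int i - t + int N" using False that by (intro mod_pos_pos_trivial) auto
      finally show ?thesis using False by simp
    qed
  qed
  show thesis
  proof (cases "I = {}")
    case True
    then show thesis using that[of 0 0] N by auto
  next
    case ne: False
    show thesis using cc
    proof
      assume "convex_in N I"
      then obtain a b where ab: "a \<le> b" "b \<le> N" "I = {a..<b}"
        using convex_in_imp_interval I by metis
      have "a < N" using ab ne by auto
      show thesis
        by (rule that[of "int a" "int b - int a"]) (use ab \<open>a < N\<close> md[of _ "int a"] in auto)
    next
      assume "convex_in N ({..<N} - I)"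
      then obtain a b where ab: "a \<le> b" "b \<le> N" "{..<N} - I = {a..<b}"
        using convex_in_imp_interval[of N "{..<N} - I"] by auto
      have mem: "i \<in> I \<longleftrightarrow> i < a \<or> b \<le> i" if "i < N" for i
        using ab(3) that by (metis DiffE DiffI atLeastLessThan_iff lessThan_iff not_le)
      show thesis
      proof (cases "b = N")
        case True
        show thesis
          by (rule that[of 0 "int a"]) (use ab True N mem in auto)
      next
        case False
        show thesis
          by (rule that[of "int b" "int N - int b + int a"]) (use ab False mem md[of _ "int b"] in auto)
      qed
    qed
  qed
qed

text \<open>
  Finitely many sets distinguish only finitely many kinds of points.
\<close>

lemma finite_representatives:
  fixes A :: "'v \<Rightarrow> 'p set"
  assumes "finite V"
  obtains P where "finite P" and "P \<subseteq> T"
    and "\<And>t. t \<in> T \<Longrightarrow> \<exists>p\<in>P. \<forall>v\<in>V. p \<in> A v \<longleftrightarrow> t \<in> A v"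
proof -
  define pat where "pat = (\<lambda>t. {v \<in> V. t \<in> A v})"
  have "finite (pat ` T)"
    using assms by (intro finite_subset[of "pat ` T" "Pow V"]) (auto simp: pat_def)
  then obtain P where P: "P \<subseteq> T" "finite P" "pat ` T = pat ` P"
    using finite_subset_image[of "pat ` T" pat T] by blast
  have "\<exists>p\<in>P. \<forall>v\<in>V. p \<in> A v \<longleftrightarrow> t \<in> A v" if "t \<in> T" for t
  proof -
    obtain p where "p \<in> P" "pat p = pat t" using \<open>t \<in> T\<close> P(3) by (metis imageE image_eqI)
    then show ?thesis unfolding pat_def by blast
  qed
  then show thesis using that P by blast
qed

text \<open>
  If the bound fails, the largest depth \<open>a\<close> satisfies \<open>m * a \<le> card V * (k - 1)\<close>. Represent the circle by
  \<open>N\<close> points, including every kind, in the order of their angles. The arcs become cyclic intervals of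
  indices, and \<open>sparse_subfamily_of_arcs\<close> yields \<open>m\<close> voters with depth below \<open>k\<close> at each of these points,
  hence at every point of the circle.
\<close>

lemma circular_deep_point:
  fixes A :: "'v \<Rightarrow> complex set"
  assumes fin: "finite V" and r: "0 < r"
    and A: "\<And>v. v \<in> V \<Longrightarrow> A v \<subseteq> sphere c r \<and> connected (A v)"
    and k: "2 \<le> k" and m: "0 < m" "m \<le> card V" and agr: "agreeing k m V A"
  shows "\<exists>p\<in>sphere c r. (k - 1) * card V < m * card {v \<in> V. p \<in> A v}"
proof (rule ccontr)
  assume "\<not> ?thesis"
  then have low: "m * card {v \<in> V. p \<in> A v} \<le> (k - 1) * card V" if "p \<in> sphere c r" for p
    using that by (auto simp: not_less)
  define B where "B = (\<lambda>v. {\<theta>. circle_point c r \<theta> \<in> A v})"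
  obtain p where p: "\<And>q. card {v \<in> V. q \<in> A v} \<le> card {v \<in> V. p \<in> A v}"
    using deepest_point[OF fin] by blast
  define a where "a = card {v \<in> V. p \<in> A v}"
  have "k \<le> a"
    using agreeing_imp_deep_point[OF agr fin m(2)] p unfolding a_def by (meson order_trans)
  then have "{v \<in> V. p \<in> A v} \<noteq> {}" using k unfolding a_def by force
  then have "p \<in> sphere c r" using A by blast
  then have count: "m * a \<le> card V * (k - 1)" using low unfolding a_def by (simp add: mult.commute)
  obtain P where P: "finite P" "P \<subseteq> {0..<2 * pi}"
    and rep: "\<And>\<theta>. \<theta> \<in> {0..<2 * pi} \<Longrightarrow> \<exists>p\<in>P. \<forall>v\<in>V. p \<in> B v \<longleftrightarrow> \<theta> \<in> B v"
    using finite_representatives[OF fin, of "{0..<2 * pi}" B] by blast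
  define N where "N = card P"
  have N0: "0 < N"
    using rep[of 0] P(1) unfolding N_def by (auto simp: card_gt_0_iff)
  define pt where "pt = (\<lambda>i. sorted_list_of_set P ! i)"
  have pt_mem: "pt i \<in> P" if "i < N" for i
    using that P(1) nth_mem[of i "sorted_list_of_set P"] unfolding pt_def N_def by simp
  have pt_less: "pt i < pt j" if "i < j" "j < N" for i j
    using that strict_sorted_list_of_set[of P] unfolding pt_def N_def
    by (simp add: sorted_wrt_iff_nth_less)
  have pt_surj: "\<exists>i<N. pt i = x" if "x \<in> P" for x
    using that P(1) unfolding pt_def N_def by (metis in_set_conv_nth length_sorted_list_of_set set_sorted_list_of_set)
  define I where "I = (\<lambda>v. {i. i < N \<and> pt i \<in> B v})"
  have convex: "convex_in N (I v) \<or> convex_in N ({..<N} - I v)" if v: "v \<in> V" for v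
  proof (rule ccontr)
    assume "\<not> ?thesis"
    then obtain i1 i2 i3 j1 j2 j3 where
      i: "i1 < i2" "i2 < i3" "i3 < N" "i1 \<in> I v" "i2 \<notin> I v" "i3 \<in> I v" and
      j: "j1 < j2" "j2 < j3" "j3 < N" "j1 \<notin> I v" "j2 \<in> I v" "j3 \<notin> I v"
      unfolding convex_in_def by auto
    \<comment> \<open>Two violations of convexity, one for the set and one for its complement, always
      contain an alternating sequence of four indices.\<close>
    have no: False if "a1 < a2" "a2 < a3" "a3 < a4" "a4 < N"
      "a1 \<in> I v \<longleftrightarrow> a3 \<in> I v" "a2 \<in> I v \<longleftrightarrow> a4 \<in> I v" "\<not> (a1 \<in> I v \<longleftrightarrow> a2 \<in> I v)" for a1 a2 a3 a4
    proof -
      have "0 \<le> pt a1" "pt a4 < 2 * pi" using pt_mem[of a1] pt_mem[of a4] P(2) that by auto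
      then show False
        using no_alternation[of "A v" c r "pt a1" "pt a2" "pt a3" "pt a4"] A[OF v] r that
          pt_less[of a1 a2] pt_less[of a2 a3] pt_less[of a3 a4]
        unfolding I_def B_def by auto
    qed
    have neq: "j1 \<noteq> i1" "j1 \<noteq> i3" "j3 \<noteq> i1" "j3 \<noteq> i3" using i j by auto
    consider "j1 < i1" | "i1 < j1" "j1 < i3" "i3 < j3" | "i1 < j1" "j3 < i3" | "i3 < j1"
      using neq by linarith
    then show False
    proof cases
      case 1
      then show False using no[of j1 i1 i2 i3] i j by auto
    next
      case 2
      then show False using no[of i1 j1 i3 j3] i j by auto
    next
      case 3
      then show False using no[of i1 j1 j2 j3] i j by auto
    next
      case 4
      then show False using no[of i1 i2 j2 j3] i j by auto
    qed
  qed
  have "\<exists>s l. 0 \<le> s \<and> s < int N \<and> 0 \<le> l \<and> l \<le> int N \<and>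
      (\<forall>i<N. i \<in> I v \<longleftrightarrow> (int i - s) mod int N < l)" if "v \<in> V" for v
  proof -
    have "I v \<subseteq> {..<N}" unfolding I_def by auto
    from arc_encoding[OF convex[OF that] this N0]
    show ?thesis by metis
  qed
  then obtain s l where sl: "\<And>v. v \<in> V \<Longrightarrow> 0 \<le> s v \<and> s v < int N \<and> 0 \<le> l v \<and> l v \<le> int N"
    and enc: "\<And>v i. v \<in> V \<Longrightarrow> i < N \<Longrightarrow> i \<in> I v \<longleftrightarrow> (int i - s v) mod int N < l v"
    by metis
  have depth: "arc_depth (int N) s l V x \<le> a" for x
  proof -
    define i where "i = nat (x mod int N)"
    have i: "i < N" "int i = x mod int N"
      using N0 unfolding i_def by (auto simp: nat_less_iff)
    have "(x - s v) mod int N = (int i - s v) mod int N" for v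
      unfolding i(2) by (simp add: mod_simps)
    then have "{v \<in> V. (x - s v) mod int N < l v} = {v \<in> V. circle_point c r (pt i) \<in> A v}"
      using enc i(1) unfolding I_def B_def by auto
    then show ?thesis unfolding arc_depth_def a_def using p by simp
  qed
  obtain W where W: "W \<subseteq> V" "card W = m" "\<And>x. arc_depth (int N) s l W x \<le> k - 1"
    using sparse_subfamily_of_arcs[OF fin m count, of s "int N" l] sl depth by blast
  then obtain U q where U: "U \<subseteq> W" "card U = k" "\<And>v. v \<in> U \<Longrightarrow> q \<in> A v"
    using agreeing_obtain[OF agr W(1,2)] by metis
  have "U \<noteq> {}" using U(2) k by auto
  then have "q \<in> sphere c r" using U W(1) A by blast
  then obtain \<theta> where \<theta>: "\<theta> \<in> {0..<2 * pi}" "q = circle_point c r \<theta>"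
    using sphere_imp_circle_point[OF _ r] by blast
  obtain x where x: "x \<in> P" "\<And>v. v \<in> V \<Longrightarrow> x \<in> B v \<longleftrightarrow> \<theta> \<in> B v" using rep[OF \<theta>(1)] by blast
  obtain i where i: "i < N" "pt i = x" using pt_surj[OF x(1)] by blast
  have "U \<subseteq> {v \<in> W. (int i - s v) mod int N < l v}"
  proof
    fix v assume v: "v \<in> U"
    then have "v \<in> V" using U W by blast
    moreover have "\<theta> \<in> B v" using U(3)[OF v] \<theta>(2) unfolding B_def by simp
    ultimately have "i \<in> I v" using x(2) i unfolding I_def by simp
    then show "v \<in> {v \<in> W. (int i - s v) mod int N < l v}"
      using enc[OF \<open>v \<in> V\<close> i(1)] v U(1) by blast
  qed
  moreover have "finite W" using W(1) fin finite_subset by blast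
  ultimately have "k \<le> arc_depth (int N) s l W (int i)"
    unfolding arc_depth_def using U(2) card_mono[of "{v \<in> W. (int i - s v) mod int N < l v}" U] by simp
  then show False using W(3)[of "int i"] k by simp
qed

section \<open>Product societies\<close>

lemma agreement_number_ge:
  assumes "finite (voters S)" and "p \<in> spectrum S"
  shows "card {v \<in> voters S. p \<in> approval S v} \<le> agreement_number S"
proof -
  have "(\<lambda>p. card {v \<in> voters S. p \<in> approval S v}) ` spectrum S \<subseteq> {..card (voters S)}"
    using card_mono[OF assms(1)] by (simp add: image_subset_iff)
  then have "finite ((\<lambda>p. card {v \<in> voters S. p \<in> approval S v}) ` spectrum S)"
    using finite_subset by blast
  then show ?thesis unfolding agreement_number_def using assms(2) by (intro Max_ge) auto
qed

lemma agreeing_subset: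
  assumes "agreeing k m V A" and "V' \<subseteq> V"
  shows "agreeing k m V' A"
  unfolding agreeing_def
proof (intro allI impI)
  fix W assume "W \<subseteq> V'" and "card W = m"
  then show "\<exists>U\<subseteq>W. card U = k \<and> (\<exists>p. \<forall>v\<in>U. p \<in> A v)"
    using agreeing_obtain[OF assms(1), of W] assms(2) by (metis order_trans)
qed

lemma product_agreeing:
  assumes "is_product_society S X Y" and "agreeable k m S"
  shows "agreeing k m (voters S) (approval X)" and "agreeing k m (voters S) (approval Y)"
proof -
  have U: "(\<exists>U\<subseteq>W. card U = k \<and> (\<exists>p. \<forall>v\<in>U. p \<in> approval X v)) \<and>
      (\<exists>U\<subseteq>W. card U = k \<and> (\<exists>q. \<forall>v\<in>U. q \<in> approval Y v))"
    if W: "W \<subseteq> voters S" "card W = m" for W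
  proof -
    obtain U z where U: "U \<subseteq> W" "card U = k" "\<forall>v\<in>U. z \<in> approval S v"
      using assms(2) W unfolding agreeable_def by auto
    have "fst z \<in> approval X v \<and> snd z \<in> approval Y v" if "v \<in> U" for v
    proof -
      have "v \<in> voters S" using that U(1) W(1) by auto
      then have "z \<in> approval X v \<times> approval Y v"
        using U(3) that assms(1) unfolding is_product_society_def by auto
      then show ?thesis by auto
    qed
    then have "\<forall>v\<in>U. fst z \<in> approval X v" "\<forall>v\<in>U. snd z \<in> approval Y v" by auto
    then show ?thesis using U(1,2) by metis
  qed
  show "agreeing k m (voters S) (approval X)" "agreeing k m (voters S) (approval Y)"
    unfolding agreeing_def by (intro allI impI, drule (1) U, elim conjE, assumption)+
qed

text \<open>
  \<open>R\<close> is the relation between the size of a family and the depth that the second factor guarantees; it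
  is left open because the guarantee is strict for circular and weak for linear societies.
\<close>

lemma product_agreement:
  fixes \<alpha> :: real and R :: "nat \<Rightarrow> nat \<Rightarrow> bool"
  assumes prod: "is_product_society S X Y" and fin: "finite (voters S)" and agr: "agreeable k m S"
    and size: "real m \<le> \<alpha> * real (society_size S)"
    and X: "agreeing k m (voters S) (approval X) \<Longrightarrow>
      \<exists>p\<in>spectrum X. \<alpha> * card (voters S) \<le> card {v \<in> voters S. p \<in> approval X v}"
    and Y: "\<And>V. V \<subseteq> voters S \<Longrightarrow> m \<le> card V \<Longrightarrow> agreeing k m V (approval Y) \<Longrightarrow>
      \<exists>q\<in>spectrum Y. R (card V) (card {v \<in> V. q \<in> approval Y v})"
  shows "\<exists>n b. \<alpha> * real (society_size S) \<le> real n \<and> R n b \<and> b \<le> agreement_number S"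
proof -
  obtain p where p: "p \<in> spectrum X" "\<alpha> * card (voters S) \<le> card {v \<in> voters S. p \<in> approval X v}"
    using X product_agreeing(1)[OF prod agr] by blast
  define V where "V = {v \<in> voters S. p \<in> approval X v}"
  have "m \<le> card V" using p(2) size unfolding V_def society_size_def by simp
  moreover have "V \<subseteq> voters S" unfolding V_def by blast
  ultimately obtain q where q: "q \<in> spectrum Y" "R (card V) (card {v \<in> V. q \<in> approval Y v})"
    using Y agreeing_subset[OF product_agreeing(2)[OF prod agr]] by blast
  have "{v \<in> V. q \<in> approval Y v} = {v \<in> voters S. (p, q) \<in> approval S v}"
    using prod unfolding V_def is_product_society_def by auto
  moreover have "(p, q) \<in> spectrum S" using prod p q unfolding is_product_society_def by auto
  ultimately have "card {v \<in> V. q \<in> approval Y v} \<le> agreement_number S"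
    using agreement_number_ge[OF fin, of "(p, q)"] by simp
  moreover have "\<alpha> * real (society_size S) \<le> real (card V)"
    using p(2) unfolding V_def society_size_def .
  ultimately show ?thesis using q(2) by (intro exI conjI)
qed

lemma linear_society_deep_point:
  assumes X: "linear_society X" and V: "V \<subseteq> voters X"
    and k: "2 \<le> k" "k \<le> m" and m: "m \<le> card V" and agr: "agreeing k m V (approval X)"
  shows "\<exists>p\<in>spectrum X. (real k - 1) / (real m - 1) * real (card V) \<le> real (card {v \<in> V. p \<in> approval X v})"
proof -
  have soc: "finite (voters X)" "\<And>v. v \<in> voters X \<Longrightarrow> approval X v \<subseteq> spectrum X"
    "\<And>v. v \<in> voters X \<Longrightarrow> \<exists>x y. approval X v = {x..y}"
    using X unfolding linear_society_def is_society_def by simp_all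
  have fin: "finite V" using soc(1) V finite_subset by metis
  have "\<exists>p. (k - 1) * card V \<le> (m - 1) * card {v \<in> V. p \<in> approval X v}"
    using soc(3) V by (intro linear_deep_point[OF fin _ k(1) m agr]) (simp add: subset_iff)
  then obtain p where p: "(k - 1) * card V \<le> (m - 1) * card {v \<in> V. p \<in> approval X v}" ..
  have "0 < (k - 1) * card V" using k m by simp
  then have "{v \<in> V. p \<in> approval X v} \<noteq> {}" using p by force
  then obtain v where "v \<in> V" "p \<in> approval X v" by auto
  then have "p \<in> spectrum X" using soc(2) V subsetD by metis
  moreover have "(real k - 1) * real (card V) \<le> (real m - 1) * real (card {v \<in> V. p \<in> approval X v})"
  proof -
    have "real ((k - 1) * card V) \<le> real ((m - 1) * card {v \<in> V. p \<in> approval X v})"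
      using p by (simp only: of_nat_le_iff)
    then show ?thesis using k by (simp add: of_nat_diff)
  qed
  ultimately show ?thesis using k by (intro bexI[of _ p]) (simp_all add: field_simps)
qed

lemma circular_society_deep_point:
  assumes X: "circular_society X" and V: "V \<subseteq> voters X"
    and k: "2 \<le> k" "k \<le> m" and m: "m \<le> card V" and agr: "agreeing k m V (approval X)"
  shows "\<exists>p\<in>spectrum X. (real k - 1) / real m * real (card V) < real (card {v \<in> V. p \<in> approval X v})"
proof -
  have soc: "finite (voters X)" "\<And>v. v \<in> voters X \<Longrightarrow> approval X v \<subseteq> spectrum X"
    "\<And>v. v \<in> voters X \<Longrightarrow> connected (approval X v)" "\<exists>c r. 0 < r \<and> spectrum X = sphere c r"
    using X unfolding circular_society_def is_society_def by simp_all
  have fin: "finite V" using soc(1) V finite_subset by metis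
  obtain c r where cr: "0 < r" "spectrum X = sphere c r" using soc(4) by (elim exE conjE)
  have arcs: "approval X v \<subseteq> sphere c r \<and> connected (approval X v)" if "v \<in> V" for v
    using soc(2,3)[of v] V that cr(2) by (simp add: subset_iff)
  have "0 < m" using k by simp
  have "\<exists>p\<in>sphere c r. (k - 1) * card V < m * card {v \<in> V. p \<in> approval X v}"
    by (rule circular_deep_point[OF fin cr(1) _ k(1) \<open>0 < m\<close> m agr]) (rule arcs)
  then obtain p where p: "p \<in> sphere c r" "(k - 1) * card V < m * card {v \<in> V. p \<in> approval X v}"
    by (elim bexE)
  have "(real k - 1) * real (card V) < real m * real (card {v \<in> V. p \<in> approval X v})"
  proof -
    have "real ((k - 1) * card V) < real (m * card {v \<in> V. p \<in> approval X v})"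
      using p(2) by (simp only: of_nat_less_iff)
    then show ?thesis using k by (simp add: of_nat_diff)
  qed
  then show ?thesis using p(1) cr k by (intro bexI[of _ p]) (simp_all add: field_simps)
qed

theorem theorem7:
  fixes k m :: nat
  assumes "2 \<le> k" and "k \<le> m"
  shows
    "(\<forall>S :: (real \<times> real, 'v) society.
        agreeable k m S \<and> two_box_society S \<and>
        real (society_size S) \<ge> real m * (real m - 1) / (real k - 1) \<longrightarrow>
        agreement_proportion S \<ge> (real k - 1)^2 / (real m - 1)^2) \<and>
     (\<forall>S :: (real \<times> complex, 'v) society.
        agreeable k m S \<and> cylindrical_society S \<and>
        real (society_size S) \<ge> real m * (real m - 1) / (real k - 1) \<longrightarrow>
        agreement_proportion S > (real k - 1)^2 / (real m * (real m - 1))) \<and>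
     (\<forall>S :: (complex \<times> complex, 'v) society.
        agreeable k m S \<and> toroidal_society S \<and>
        real (society_size S) \<ge> (real m)^2 / (real k - 1) \<longrightarrow>
        agreement_proportion S > (real k - 1)^2 / (real m)^2)"
proof (intro conjI allI impI; elim conjE)
  fix S :: "(real \<times> real, 'v) society"
  assume agr: "agreeable k m S" and "two_box_society S"
    and size: "real m * (real m - 1) / (real k - 1) \<le> real (society_size S)"
  then obtain X Y where XY: "linear_society X" "linear_society Y" "is_product_society S X Y"
    unfolding two_box_society_def by blast
  have V: "voters X = voters S" "voters Y = voters S" using XY(3) unfolding is_product_society_def by auto
  have fin: "finite (voters S)" using XY(1) V unfolding linear_society_def is_society_def by simp
  have mS: "m \<le> card (voters S)" using agr unfolding agreeable_def society_size_def by simp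
  define \<alpha> where "\<alpha> = (real k - 1) / (real m - 1)"
  have \<alpha>: "0 < \<alpha>" using assms unfolding \<alpha>_def by simp
  have big: "real m \<le> \<alpha> * real (society_size S)"
    using size assms unfolding \<alpha>_def by (simp add: field_simps)
  have deepX: "\<exists>p\<in>spectrum X. \<alpha> * card (voters S) \<le> card {v \<in> voters S. p \<in> approval X v}"
    if "agreeing k m (voters S) (approval X)"
    using linear_society_deep_point[OF XY(1) _ assms mS that] V(1) unfolding \<alpha>_def by force
  have deepY: "\<exists>q\<in>spectrum Y. \<alpha> * real (card W) \<le> real (card {v \<in> W. q \<in> approval Y v})"
    if "W \<subseteq> voters S" "m \<le> card W" "agreeing k m W (approval Y)" for W
    using linear_society_deep_point[OF XY(2) _ assms that(2,3)] that(1) V(2) unfolding \<alpha>_def by simp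
  have "\<exists>n b. \<alpha> * real (society_size S) \<le> real n \<and> \<alpha> * real n \<le> real b \<and> b \<le> agreement_number S"
    by (rule product_agreement[where R = "\<lambda>n b. \<alpha> * real n \<le> real b", OF XY(3) fin agr big]) (rule deepX deepY | assumption)+
  then obtain n b where nb: "\<alpha> * real (society_size S) \<le> real n" "\<alpha> * real n \<le> real b" "b \<le> agreement_number S"
    by (elim exE conjE)
  have "\<alpha> * (\<alpha> * real (society_size S)) \<le> \<alpha> * real n" using nb(1) \<alpha> by simp
  then have "\<alpha> ^ 2 * real (society_size S) \<le> real (agreement_number S)"
    using nb by (simp add: power2_eq_square)
  moreover have "0 < society_size S" using mS assms unfolding society_size_def by simp
  ultimately have "\<alpha> ^ 2 \<le> agreement_proportion S"
    unfolding agreement_proportion_def by (simp add: pos_le_divide_eq)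
  then show "(real k - 1)^2 / (real m - 1)^2 \<le> agreement_proportion S"
    unfolding \<alpha>_def by (simp add: power_divide)
next
  fix S :: "(real \<times> complex, 'v) society"
  assume agr: "agreeable k m S" and "cylindrical_society S"
    and size: "real m * (real m - 1) / (real k - 1) \<le> real (society_size S)"
  then obtain X Y where XY: "linear_society X" "circular_society Y" "is_product_society S X Y"
    unfolding cylindrical_society_def by blast
  have V: "voters X = voters S" "voters Y = voters S" using XY(3) unfolding is_product_society_def by auto
  have fin: "finite (voters S)" using XY(1) V unfolding linear_society_def is_society_def by simp
  have mS: "m \<le> card (voters S)" using agr unfolding agreeable_def society_size_def by simp
  define \<alpha> \<beta> where "\<alpha> = (real k - 1) / (real m - 1)" and "\<beta> = (real k - 1) / real m"
  have \<beta>: "0 < \<beta>" using assms unfolding \<beta>_def by simp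
  have big: "real m \<le> \<alpha> * real (society_size S)"
    using size assms unfolding \<alpha>_def by (simp add: field_simps)
  have deepX: "\<exists>p\<in>spectrum X. \<alpha> * card (voters S) \<le> card {v \<in> voters S. p \<in> approval X v}"
    if "agreeing k m (voters S) (approval X)"
    using linear_society_deep_point[OF XY(1) _ assms mS that] V(1) unfolding \<alpha>_def by force
  have deepY: "\<exists>q\<in>spectrum Y. \<beta> * real (card W) < real (card {v \<in> W. q \<in> approval Y v})"
    if "W \<subseteq> voters S" "m \<le> card W" "agreeing k m W (approval Y)" for W
    using circular_society_deep_point[OF XY(2) _ assms that(2,3)] that(1) V(2) unfolding \<beta>_def by simp
  have "\<exists>n b. \<alpha> * real (society_size S) \<le> real n \<and> \<beta> * real n < real b \<and> b \<le> agreement_number S"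
    by (rule product_agreement[where R = "\<lambda>n b. \<beta> * real n < real b", OF XY(3) fin agr big]) (rule deepX deepY | assumption)+
  then obtain n b where nb: "\<alpha> * real (society_size S) \<le> real n" "\<beta> * real n < real b" "b \<le> agreement_number S"
    by (elim exE conjE)
  have "\<beta> * (\<alpha> * real (society_size S)) \<le> \<beta> * real n" using nb(1) \<beta> by simp
  then have "(\<beta> * \<alpha>) * real (society_size S) < real (agreement_number S)"
    using nb by simp
  moreover have "0 < society_size S" using mS assms unfolding society_size_def by simp
  ultimately have "\<beta> * \<alpha> < agreement_proportion S"
    unfolding agreement_proportion_def by (simp add: pos_less_divide_eq)
  then show "(real k - 1)^2 / (real m * (real m - 1)) < agreement_proportion S"
    unfolding \<alpha>_def \<beta>_def by (simp add: power2_eq_square)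
next
  fix S :: "(complex \<times> complex, 'v) society"
  assume agr: "agreeable k m S" and "toroidal_society S"
    and size: "(real m)^2 / (real k - 1) \<le> real (society_size S)"
  then obtain X Y where XY: "circular_society X" "circular_society Y" "is_product_society S X Y"
    unfolding toroidal_society_def by blast
  have V: "voters X = voters S" "voters Y = voters S" using XY(3) unfolding is_product_society_def by auto
  have fin: "finite (voters S)" using XY(1) V unfolding circular_society_def is_society_def by simp
  have mS: "m \<le> card (voters S)" using agr unfolding agreeable_def society_size_def by simp
  define \<beta> where "\<beta> = (real k - 1) / real m"
  have \<beta>: "0 < \<beta>" using assms unfolding \<beta>_def by simp
  have big: "real m \<le> \<beta> * real (society_size S)"
    using size assms unfolding \<beta>_def by (simp add: field_simps power2_eq_square)
  have deepX: "\<exists>p\<in>spectrum X. \<beta> * card (voters S) \<le> card {v \<in> voters S. p \<in> approval X v}"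
    if "agreeing k m (voters S) (approval X)"
    using circular_society_deep_point[OF XY(1) _ assms mS that] V(1) unfolding \<beta>_def by force
  have deepY: "\<exists>q\<in>spectrum Y. \<beta> * real (card W) < real (card {v \<in> W. q \<in> approval Y v})"
    if "W \<subseteq> voters S" "m \<le> card W" "agreeing k m W (approval Y)" for W
    using circular_society_deep_point[OF XY(2) _ assms that(2,3)] that(1) V(2) unfolding \<beta>_def by simp
  have "\<exists>n b. \<beta> * real (society_size S) \<le> real n \<and> \<beta> * real n < real b \<and> b \<le> agreement_number S"
    by (rule product_agreement[where R = "\<lambda>n b. \<beta> * real n < real b", OF XY(3) fin agr big]) (rule deepX deepY | assumption)+
  then obtain n b where nb: "\<beta> * real (society_size S) \<le> real n" "\<beta> * real n < real b" "b \<le> agreement_number S"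
    by (elim exE conjE)
  have "\<beta> * (\<beta> * real (society_size S)) \<le> \<beta> * real n" using nb(1) \<beta> by simp
  then have "\<beta> ^ 2 * real (society_size S) < real (agreement_number S)"
    using nb by (simp add: power2_eq_square)
  moreover have "0 < society_size S" using mS assms unfolding society_size_def by simp
  ultimately have "\<beta> ^ 2 < agreement_proportion S"
    unfolding agreement_proportion_def by (simp add: pos_less_divide_eq)
  then show "(real k - 1)^2 / (real m)^2 < agreement_proportion S"
    unfolding \<beta>_def by (simp add: power_divide)
qed

end
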